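(* Let $R$ be a finite ring, let $r\in R$, and let $x$ be any vertex of the graph $\Gamma_R^r$ (that is, any $x\in R$). Then: (a) if $r=0$, then $\deg(x)=|R|-|C_R(x)|$; (b) if $r\neq 0$, then $$\deg(x)=\begin{cases}|R|-|T_{x,r}|-1, & \text{if } 2r=0,\\ |R|-2|T_{x,r}|-1, & \text{if } 2r\neq 0.\end{cases}$$
   Context: Rings are associative and not assumed to have a unity. $[x,y]:=xy-yx$. $C_R(x):=\{y\in R: xy=yx\}$. For $x,r\in R$, $T_{x,r}:=\{y\in R:[x,y]=r\}$. The $r$-noncommuting graph $\Gamma_R^r$ is the simple undirected graph with vertex set $R$ in which two distinct vertices $x,y$ are adjacent if and only if $[x,y]\neq r$ and $[x,y]\neq -r$. $\deg(x)$ is the degree of $x$ in $\Gamma_R^r$. *)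

theory Defs
  imports Main
begin

text \<open>The class \<open>ring\<close> is that of associative rings without the requirement of a unity;
  the ring is the whole type.\<close>

definition commutator :: "'a::ring \<Rightarrow> 'a \<Rightarrow> 'a" where
  "commutator x y = x * y - y * x"

definition centralizer :: "'a::ring \<Rightarrow> 'a set" where
  "centralizer x = {y. x * y = y * x}"

definition T_set :: "'a::ring \<Rightarrow> 'a \<Rightarrow> 'a set" where
  "T_set x r = {y. commutator x y = r}"

text \<open>An undirected graph is a pair of a vertex set and a set of edges; in a simple graph
  every edge is a two-element set of vertices.\<close>

type_synonym 'a ugraph = "'a set \<times> 'a set set"

definition simple_graph :: "'a ugraph \<Rightarrow> bool" where
  "simple_graph G \<longleftrightarrow> (\<forall>e \<in> snd G. e \<subseteq> fst G \<and> card e = 2)"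

definition adjacent :: "'a ugraph \<Rightarrow> 'a \<Rightarrow> 'a \<Rightarrow> bool" where
  "adjacent G x y \<longleftrightarrow> {x, y} \<in> snd G"

definition degree :: "'a ugraph \<Rightarrow> 'a \<Rightarrow> nat" where
  "degree G x = card {y \<in> fst G. adjacent G x y}"

definition noncommuting_graph :: "'a::ring \<Rightarrow> 'a ugraph" where
  "noncommuting_graph r =
     (UNIV, {{x, y} | x y. x \<noteq> y \<and> commutator x y \<noteq> r \<and> commutator x y \<noteq> - r})"

lemma commutator_swap: "commutator y x = - commutator x y"
  by (simp add: commutator_def)

lemma simple_graph_noncommuting_graph: "simple_graph (noncommuting_graph r)"
  by (auto simp: simple_graph_def noncommuting_graph_def)

lemma adjacent_noncommuting_graph_iff:
  "adjacent (noncommuting_graph r) x y \<longleftrightarrow>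
     x \<noteq> y \<and> commutator x y \<noteq> r \<and> commutator x y \<noteq> - r"
proof
  assume "adjacent (noncommuting_graph r) x y"
  then obtain a b where ab: "{x, y} = {a, b}" "a \<noteq> b" "commutator a b \<noteq> r" "commutator a b \<noteq> - r"
    by (auto simp: adjacent_def noncommuting_graph_def)
  moreover have "commutator b a \<noteq> r" "commutator b a \<noteq> - r"
    using ab(3,4) by (auto simp: commutator_swap[of b a])
  ultimately show "x \<noteq> y \<and> commutator x y \<noteq> r \<and> commutator x y \<noteq> - r"
    by (auto simp: doubleton_eq_iff)
next
  assume "x \<noteq> y \<and> commutator x y \<noteq> r \<and> commutator x y \<noteq> - r"
  then show "adjacent (noncommuting_graph r) x y"
    unfolding adjacent_def noncommuting_graph_def snd_conv by blast
qed

end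

theory Submission imports Defs begin

text \<open>The non-neighbours of \<open>x\<close> are \<open>x\<close> itself and the elements of \<open>T_set x r\<close> and \<open>T_set x (- r)\<close>.
  Negation is a bijection between these two sets, which coincide if \<open>r + r = 0\<close> and are disjoint
  otherwise; \<open>x\<close> lies in either of them only if \<open>r = 0\<close>.\<close>

lemma T_set_zero: "T_set x 0 = centralizer x"
  by (auto simp: T_set_def centralizer_def commutator_def)

lemma self_in_T_set_iff: "x \<in> T_set x r \<longleftrightarrow> r = 0"
  by (auto simp: T_set_def commutator_def)

text \<open>Since \<open>commutator x (- y) = - commutator x y\<close>, negation maps each of the
  two sets into the other.\<close>

lemma card_T_set_uminus: "card (T_set x (- r)) = card (T_set x r)"
proof -
  have "uminus ` T_set x r = T_set x (- r)"
  proof (intro equalityI subsetI)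
    fix y assume "y \<in> T_set x (- r)"
    then have "- y \<in> T_set x r"
      by (simp add: T_set_def commutator_def algebra_simps)
    then show "y \<in> uminus ` T_set x r"
      by (metis image_eqI minus_minus)
  qed (auto simp: T_set_def commutator_def)
  moreover have "inj_on uminus (T_set x r)"
    by simp
  ultimately show ?thesis
    by (metis card_image)
qed

lemma T_set_Int_uminus:
  assumes "r + r \<noteq> 0"
  shows "T_set x r \<inter> T_set x (- r) = {}"
  using assms by (auto simp: T_set_def eq_neg_iff_add_eq_0)

text \<open>Counting in \<open>int\<close> avoids truncated subtraction. The \<open>insert\<close>
  stays unevaluated because whether \<open>x\<close> already lies in the union depends on
  \<open>r\<close>.\<close>

lemma degree_noncommuting_graph:
  fixes r x :: "'a::{ring, finite}"
  shows "int (degree (noncommuting_graph r) x) =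
    int (card (UNIV :: 'a set)) - int (card (insert x (T_set x r \<union> T_set x (- r))))"
proof -
  have "{y \<in> fst (noncommuting_graph r). adjacent (noncommuting_graph r) x y} =
      - insert x (T_set x r \<union> T_set x (- r))"
    unfolding adjacent_noncommuting_graph_iff by (auto simp: T_set_def noncommuting_graph_def)
  then show ?thesis
    by (simp add: degree_def Compl_eq_Diff_UNIV card_Diff_subset of_nat_diff card_mono
        del: Diff_insert)
qed

theorem proposition2p1:
  fixes r x :: "'a::{ring, finite}"
  shows "(r = 0 \<longrightarrow>
            int (degree (noncommuting_graph r) x)
              = int (card (UNIV :: 'a set)) - int (card (centralizer x)))
       \<and> (r \<noteq> 0 \<longrightarrow>
            int (degree (noncommuting_graph r) x)
              = (if r + r = 0
                 then int (card (UNIV :: 'a set)) - int (card (T_set x r)) - 1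
                 else int (card (UNIV :: 'a set)) - 2 * int (card (T_set x r)) - 1))"
proof (intro conjI impI)
  assume "r = 0"
  \<comment> \<open>As \<open>x\<close> commutes with itself, it is already counted in
    \<open>centralizer x\<close>, so no extra 1 is subtracted.\<close>
  moreover have "insert x (centralizer x) = centralizer x"
    by (auto simp: centralizer_def)
  ultimately show "int (degree (noncommuting_graph r) x)
      = int (card (UNIV :: 'a set)) - int (card (centralizer x))"
    by (simp add: degree_noncommuting_graph T_set_zero)
next
  assume r: "r \<noteq> 0"
  \<comment> \<open>Here \<open>commutator x x = 0\<close> differs from both \<open>r\<close> and
    \<open>- r\<close>, so \<open>x\<close> is a further non-neighbour: the source of the final
    \<open>- 1\<close>.\<close>
  then have "card (insert x (T_set x r \<union> T_set x (- r))) = Suc (card (T_set x r \<union> T_set x (- r)))"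
    by (simp add: self_in_T_set_iff)
  moreover have "card (T_set x r \<union> T_set x (- r)) =
      (if r + r = 0 then card (T_set x r) else 2 * card (T_set x r))"
  proof (cases "r + r = 0")
    case True
    then have "- r = r"
      by (simp add: neg_eq_iff_add_eq_0)
    then show ?thesis
      using True by simp
  next
    case False
    \<comment> \<open>Two disjoint sets of equal size give the factor 2.\<close>
    then show ?thesis
      by (simp add: card_Un_disjoint T_set_Int_uminus card_T_set_uminus)
  qed
  ultimately show "int (degree (noncommuting_graph r) x)
      = (if r + r = 0
         then int (card (UNIV :: 'a set)) - int (card (T_set x r)) - 1
         else int (card (UNIV :: 'a set)) - 2 * int (card (T_set x r)) - 1)"
    by (simp add: degree_noncommuting_graph)
qed

end
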